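(* Let $I=(a,b,\eta^+,\eta^-)$ be a problem instance with linear base demand. There are deterministic functions $t^\dagger\in\{1,\dots,T\}$ and $p^\dagger\in[0,\bar p]$ of $(a,b,\eta^+,r)$ (for given $T,\bar p$) such that the following holds for the price curve $\tilde{\mathbf p}(r)=(p_t)_{t\in[T]}$ defined, for a reference price $r\in[0,\bar p]$, by $$p_t=\begin{cases}\bar p, & t\in[1,t^\dagger-1],\\ p^\dagger, & t=t^\dagger,\\ p_{t-1}-\dfrac{\eta^+ r_{t-1}}{2(a+\eta^+)t+\eta^+}, & t\in[t^\dagger+1,T-1],\\ \dfrac{\eta^+ r_T+b}{2(a+\eta^+)}, & t=T,\end{cases}\qquad r_t=\frac{r+\sum_{s=1}^{t-1}p_s}{t},\ t\in[T].$$ (i) If $\eta^+=\eta^-$, then $\tilde{\mathbf p}(r)$ is optimal: $V^*(r)=V^{\tilde{\mathbf p}(r)}(r)$. (ii) If $\eta^+\ne\eta^-$, then the price curve $\tilde{\mathbf p}(\bar p)$ (the curve $\tilde{\mathbf p}(r)$ taken at $r=\bar p$, i.e. with $t^\dagger,p^\dagger$ evaluated at $(a,b,\eta^+,\bar p)$ and $r_t=\frac{\bar p+\sum_{s=1}^{t-1}p_s}{t}$ used in the formula for $p_t$) is near-optimal: for every starting reference price $r\in[0,\bar p]$, $V^*(r)-V^{\tilde{\mathbf p}(\bar p)}(r)\le O(\ln T)$, where the constant in $O(\cdot)$ does not depend on $T\ge 2$.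
   Context: A seller sets prices $p_t\in[0,\bar p]$ for $t=1,\dots,T$, where $0<\bar p<\infty$. Write $x^+=\max\{x,0\}$. The expected demand at price $p$ and reference price $r$ is $D(p,r)=b-ap+\eta^+(r-p)^+-\eta^-(p-r)^+$, with $a>0$ and $\eta^+,\eta^-\ge 0$. Standing assumptions: $D(p,r)\ge 0$ for all $p,r\in[0,\bar p]$, and the maximizer $\frac{b}{2a}$ of $p(b-ap)$ lies in the interior of the price range, $\frac{b}{2a}\le\bar p-c_0$ for a constant $c_0>0$. The single-round revenue is $\mathrm{Rev}(p,r)=p\,D(p,r)$. Under the averaging reference mechanism, reference prices evolve by $r_{t+1}=\frac{t r_t+p_t}{t+1}$ from a starting reference price $r_1$. For $\mathbf p\in[0,\bar p]^T$, $V^{\mathbf p}(r)=\sum_{t=1}^T\mathrm{Rev}(p_t,r_t)$ with $r_1=r$, and $V^*(r)=\sup_{\mathbf p\in[0,\bar p]^T}V^{\mathbf p}(r)$. *)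

theory Defs
  imports Complex_Main "HOL-Library.FuncSet"
begin

definition demand :: "real \<Rightarrow> real \<Rightarrow> real \<Rightarrow> real \<Rightarrow> real \<Rightarrow> real \<Rightarrow> real" where
  "demand a b \<eta>p \<eta>m p r = b - a * p + \<eta>p * max (r - p) 0 - \<eta>m * max (p - r) 0"

definition rev1 :: "real \<Rightarrow> real \<Rightarrow> real \<Rightarrow> real \<Rightarrow> real \<Rightarrow> real \<Rightarrow> real" where
  "rev1 a b \<eta>p \<eta>m p r = p * demand a b \<eta>p \<eta>m p r"

definition standing_assms ::
  "real \<Rightarrow> real \<Rightarrow> real \<Rightarrow> real \<Rightarrow> real \<Rightarrow> real \<Rightarrow> bool" where
  "standing_assms pbar c0 a b \<eta>p \<eta>m \<longleftrightarrow>
     0 < pbar \<and> 0 < c0 \<and> 0 < a \<and> 0 \<le> \<eta>p \<and> 0 \<le> \<eta>m \<and>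
     (\<forall>p\<in>{0..pbar}. \<forall>r\<in>{0..pbar}. 0 \<le> demand a b \<eta>p \<eta>m p r) \<and>
     0 < b / (2 * a) \<and> b / (2 * a) \<le> pbar - c0"

text \<open>Rounds are numbered from 1. A price sequence is a function on \<open>nat\<close> of which only
  the values at \<open>1, \<dots>, T\<close> matter; the value of \<open>ref_price\<close> at round 0 is a dummy.\<close>

fun ref_price :: "real \<Rightarrow> (nat \<Rightarrow> real) \<Rightarrow> nat \<Rightarrow> real" where
  "ref_price r p 0 = r"
| "ref_price r p (Suc 0) = r"
| "ref_price r p (Suc (Suc t)) =
     (real (Suc t) * ref_price r p (Suc t) + p (Suc t)) / (real (Suc t) + 1)"

definition feasible :: "nat \<Rightarrow> real \<Rightarrow> (nat \<Rightarrow> real) set" where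
  "feasible T pbar = {1..T} \<rightarrow> {0..pbar}"

definition total_rev ::
  "real \<Rightarrow> real \<Rightarrow> real \<Rightarrow> real \<Rightarrow> nat \<Rightarrow> (nat \<Rightarrow> real) \<Rightarrow> real \<Rightarrow> real" where
  "total_rev a b \<eta>p \<eta>m T p r = (\<Sum>t = 1..T. rev1 a b \<eta>p \<eta>m (p t) (ref_price r p t))"

definition opt_rev ::
  "real \<Rightarrow> real \<Rightarrow> real \<Rightarrow> real \<Rightarrow> nat \<Rightarrow> real \<Rightarrow> real \<Rightarrow> real" where
  "opt_rev a b \<eta>p \<eta>m T pbar r = (SUP p \<in> feasible T pbar. total_rev a b \<eta>p \<eta>m T p r)"

definition avg_price :: "real \<Rightarrow> (nat \<Rightarrow> real) \<Rightarrow> nat \<Rightarrow> real" where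
  "avg_price r p t = (r + (\<Sum>s\<in>{1..<t}. p s)) / real t"

lemma avg_price_cong [fundef_cong]:
  assumes "r = r'" "t = t'" "\<And>s. 1 \<le> s \<Longrightarrow> s < t' \<Longrightarrow> p s = p' s"
  shows "avg_price r p t = avg_price r' p' t'"
  using assms by (simp add: avg_price_def)

lemma ref_price_eq_avg_price: "t \<ge> 1 \<Longrightarrow> ref_price r p t = avg_price r p t"
proof (induction t rule: nat_induct_at_least)
  case base
  show ?case by (simp add: avg_price_def)
next
  case (Suc t)
  then obtain k where "t = Suc k" by (cases t) auto
  with Suc show ?case by (simp add: avg_price_def field_simps)
qed

text \<open>The price curve determined by a starting reference price \<open>r\<close>, a round \<open>td\<close> and a
  price \<open>pd\<close>. If \<open>td = T\<close>, both the \<open>pd\<close> branch and the last-round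
  branch apply at round \<open>T\<close>; \<open>curve_consistent\<close> says that they then agree.\<close>

function price_curve ::
  "nat \<Rightarrow> real \<Rightarrow> real \<Rightarrow> real \<Rightarrow> real \<Rightarrow> nat \<Rightarrow> real \<Rightarrow> real \<Rightarrow> nat \<Rightarrow> real" where
  "price_curve T pbar a b \<eta>p td pd r t =
     (if t < td then pbar
      else if t = td then pd
      else if t < T then
        price_curve T pbar a b \<eta>p td pd r (t - 1)
          - \<eta>p * avg_price r (\<lambda>s. price_curve T pbar a b \<eta>p td pd r s) (t - 1)
              / (2 * (a + \<eta>p) * real t + \<eta>p)
      else
        (\<eta>p * avg_price r (\<lambda>s. price_curve T pbar a b \<eta>p td pd r s) t + b)
          / (2 * (a + \<eta>p)))"
  by pat_completeness auto
termination
  by (relation "measure (\<lambda>(T, pbar, a, b, \<eta>p, td, pd, r, t). t)") auto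

declare price_curve.simps [simp del]

definition curve_consistent ::
  "nat \<Rightarrow> real \<Rightarrow> real \<Rightarrow> real \<Rightarrow> real \<Rightarrow> nat \<Rightarrow> real \<Rightarrow> real \<Rightarrow> bool" where
  "curve_consistent T pbar a b \<eta>p td pd r \<longleftrightarrow>
     (td = T \<longrightarrow>
        pd = (\<eta>p * avg_price r (price_curve T pbar a b \<eta>p td pd r) T + b)
               / (2 * (a + \<eta>p)))"

end

theory Submission
  imports Defs "HOL-Analysis.Function_Topology" "HOL-Analysis.Harmonic_Numbers"
    "HOL-Combinatorics.Permutations"
begin

text \<open>
  The curve is a maximizer over the box \<open>[0, pbar]^T\<close>, which exists by compactness, of the
  loss-neutral revenue (both reference effects equal to \<open>\<eta>p\<close>). At a maximizer all prices are
  positive, the gradient is nonnegative, and it vanishes where the price is below \<open>pbar\<close>. The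
  difference of consecutive gradient entries then shows that prices decrease and that, after the
  first price below \<open>pbar\<close>, they obey the recurrence; no concavity or uniqueness is involved.

  For \<open>\<eta>p \<noteq> \<eta>m\<close>, a decreasing curve started at \<open>pbar\<close> never exceeds its reference price, so \<open>\<eta>m\<close>
  plays no role in its revenue; starting from \<open>r\<close> instead shifts the reference price of round \<open>t\<close>
  by at most \<open>pbar / t\<close>, which costs a harmonic sum. Conversely the loss-neutral optimum at \<open>pbar\<close>
  bounds every revenue: for \<open>\<eta>p \<le> \<eta>m\<close> demand is at most the loss-neutral one, and for
  \<open>\<eta>m < \<eta>p\<close> swapping two consecutive increasing prices never lowers revenue, so only
  decreasing curves matter.
\<close>

section \<open>Reference prices and revenue\<close>

lemma total_rev_avg_price:
  "total_rev a b \<eta>p \<eta>m T p r = (\<Sum>t = 1..T. rev1 a b \<eta>p \<eta>m (p t) (avg_price r p t))"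
  unfolding total_rev_def by (intro sum.cong) (auto simp: ref_price_eq_avg_price)

lemma total_rev_cong:
  assumes "\<And>t. t \<in> {1..T} \<Longrightarrow> p t = q t"
  shows "total_rev a b \<eta>p \<eta>m T p r = total_rev a b \<eta>p \<eta>m T q r"
  unfolding total_rev_avg_price using assms
  by (intro sum.cong refl arg_cong2[where f = "rev1 a b \<eta>p \<eta>m"] avg_price_cong) auto

lemma rev1_neutral: "rev1 a b \<eta> \<eta> p r = p * (b - (a + \<eta>) * p + \<eta> * r)"
proof -
  have "max (r - p) 0 - max (p - r) 0 = r - p" by simp
  then have "\<eta> * max (r - p) 0 - \<eta> * max (p - r) 0 = \<eta> * (r - p)"
    by (metis right_diff_distrib)
  then have "demand a b \<eta> \<eta> p r = b - (a + \<eta>) * p + \<eta> * r"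
    unfolding demand_def by (simp add: algebra_simps)
  then show ?thesis by (simp add: rev1_def)
qed

lemma rev1_markdown: "p \<le> r \<Longrightarrow> rev1 a b \<eta>p \<eta>m p r = rev1 a b \<eta>p \<eta>p p r"
  by (simp add: rev1_def demand_def max_def)

lemma rev1_mono:
  assumes "0 \<le> p" "0 \<le> \<eta>p" "0 \<le> \<eta>m" "r \<le> r'"
  shows "rev1 a b \<eta>p \<eta>m p r \<le> rev1 a b \<eta>p \<eta>m p r'"
proof -
  have "\<eta>p * max (r - p) 0 \<le> \<eta>p * max (r' - p) 0"
    and "\<eta>m * max (p - r') 0 \<le> \<eta>m * max (p - r) 0"
    using assms by (auto intro!: mult_left_mono)
  then show ?thesis
    unfolding rev1_def demand_def using assms(1) by (intro mult_left_mono) auto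
qed

lemma rev1_le_neutral:
  assumes "0 \<le> p" "\<eta>p \<le> \<eta>m"
  shows "rev1 a b \<eta>p \<eta>m p r \<le> rev1 a b \<eta>p \<eta>p p r"
proof -
  have "\<eta>p * max (p - r) 0 \<le> \<eta>m * max (p - r) 0"
    using assms by (intro mult_right_mono) auto
  then show ?thesis
    unfolding rev1_def demand_def using assms(1) by (intro mult_left_mono) auto
qed

lemma rev1_lipschitz:
  assumes "0 \<le> p" "0 \<le> \<eta>p" "0 \<le> \<eta>m" "r \<le> r'"
  shows "rev1 a b \<eta>p \<eta>m p r' - rev1 a b \<eta>p \<eta>m p r \<le> p * ((\<eta>p + \<eta>m) * (r' - r))"
proof -
  have "\<eta>p * (max (r' - p) 0 - max (r - p) 0) \<le> \<eta>p * (r' - r)"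
    and "\<eta>m * (max (p - r) 0 - max (p - r') 0) \<le> \<eta>m * (r' - r)"
    using assms by (auto intro!: mult_left_mono)
  then have "demand a b \<eta>p \<eta>m p r' - demand a b \<eta>p \<eta>m p r \<le> (\<eta>p + \<eta>m) * (r' - r)"
    unfolding demand_def by (simp add: algebra_simps)
  from mult_left_mono[OF this assms(1)] show ?thesis
    unfolding rev1_def by (simp add: algebra_simps)
qed

section \<open>Bounds and recursion for average prices\<close>

lemma avg_price_mono: "r \<le> r' \<Longrightarrow> avg_price r p t \<le> avg_price r' p t"
  unfolding avg_price_def by (intro divide_right_mono) auto

lemma avg_price_nonneg:
  assumes "0 \<le> r" "\<And>s. s \<in> {1..<t} \<Longrightarrow> 0 \<le> p s"
  shows "0 \<le> avg_price r p t"
  unfolding avg_price_def by (intro divide_nonneg_nonneg add_nonneg_nonneg sum_nonneg assms) auto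

lemma avg_price_le:
  assumes "t \<ge> 1" "r \<le> c" "\<And>s. s \<in> {1..<t} \<Longrightarrow> p s \<le> c"
  shows "avg_price r p t \<le> c"
proof -
  have "(\<Sum>s\<in>{1..<t}. p s) \<le> of_nat (card {1..<t}) * c"
    by (rule sum_bounded_above) (use assms in auto)
  then have "r + (\<Sum>s\<in>{1..<t}. p s) \<le> real t * c"
    using assms by (simp add: of_nat_diff algebra_simps)
  then show ?thesis
    unfolding avg_price_def using assms by (simp add: field_simps)
qed

lemma avg_price_ge:
  assumes "t \<ge> 1" "c \<le> r" "\<And>s. s \<in> {1..<t} \<Longrightarrow> c \<le> p s"
  shows "c \<le> avg_price r p t"
proof -
  have "of_nat (card {1..<t}) * c \<le> (\<Sum>s\<in>{1..<t}. p s)"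
    by (rule sum_bounded_below) (use assms in auto)
  then have "real t * c \<le> r + (\<Sum>s\<in>{1..<t}. p s)"
    using assms by (simp add: of_nat_diff algebra_simps)
  then show ?thesis
    unfolding avg_price_def using assms by (simp add: field_simps)
qed

text \<open>Recursion as a move of weight \<open>1 / (t + 1)\<close> from the old reference towards
  the price just charged; both the gradient differences and the swap argument use it in this
  form.\<close>

lemma avg_price_Suc:
  assumes "t \<ge> 1"
  shows "avg_price r p (Suc t) = avg_price r p t + (p t - avg_price r p t) / (real t + 1)"
proof -
  have "{1..<Suc t} = insert t {1..<t}" using assms by auto
  then have "avg_price r p (Suc t) * (real t + 1) = real t * avg_price r p t + p t"
    using assms by (simp add: avg_price_def add.commute)
  then show ?thesis by (simp add: field_simps)
qed

section \<open>Dependence of revenue on the starting reference price\<close>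

lemma total_rev_mono_ref:
  assumes "p \<in> feasible T pbar" "0 \<le> \<eta>p" "0 \<le> \<eta>m" "r \<le> r'"
  shows "total_rev a b \<eta>p \<eta>m T p r \<le> total_rev a b \<eta>p \<eta>m T p r'"
  unfolding total_rev_avg_price using assms
  by (intro sum_mono rev1_mono avg_price_mono) (auto simp: feasible_def)

text \<open>By round \<open>t\<close> the starting reference carries weight only
  \<open>1 / t\<close> in the average, and demand is Lipschitz in the reference, so the losses add
  up to a harmonic sum.\<close>

lemma total_rev_lipschitz_ref:
  assumes "p \<in> feasible T pbar" "0 \<le> \<eta>p" "0 \<le> \<eta>m" "0 \<le> r" "r \<le> pbar"
  shows "total_rev a b \<eta>p \<eta>m T p pbar - total_rev a b \<eta>p \<eta>m T p r
           \<le> pbar\<^sup>2 * (\<eta>p + \<eta>m) * harm T"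
proof -
  have "rev1 a b \<eta>p \<eta>m (p t) (avg_price pbar p t) - rev1 a b \<eta>p \<eta>m (p t) (avg_price r p t)
          \<le> pbar\<^sup>2 * (\<eta>p + \<eta>m) * inverse (real t)" if t: "t \<in> {1..T}" for t
  proof -
    have p: "0 \<le> p t" "p t \<le> pbar" using assms(1) t by (auto simp: feasible_def)
    have diff: "avg_price pbar p t - avg_price r p t = (pbar - r) / real t"
      by (simp add: avg_price_def diff_divide_distrib [symmetric])
    have "rev1 a b \<eta>p \<eta>m (p t) (avg_price pbar p t) - rev1 a b \<eta>p \<eta>m (p t) (avg_price r p t)
        \<le> p t * ((\<eta>p + \<eta>m) * (avg_price pbar p t - avg_price r p t))"
      using assms p by (intro rev1_lipschitz avg_price_mono) auto
    also have "\<dots> \<le> pbar * ((\<eta>p + \<eta>m) * (pbar / real t))"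
      unfolding diff using assms p by (intro mult_mono divide_right_mono) auto
    finally show ?thesis by (simp add: power2_eq_square field_simps)
  qed
  then show ?thesis
    unfolding total_rev_avg_price sum_subtractf [symmetric] harm_def sum_distrib_left
    by (rule sum_mono)
qed

text \<open>The reference averages numbers that are all at least the current price, so the loss term
  never becomes active.\<close>

lemma total_rev_markdown:
  assumes "antimono_on {1..T} p" "\<And>t. t \<in> {1..T} \<Longrightarrow> p t \<le> r"
  shows "total_rev a b \<eta>p \<eta>m T p r = total_rev a b \<eta>p \<eta>p T p r"
  unfolding total_rev_avg_price
proof (intro sum.cong refl rev1_markdown)
  fix t assume t: "t \<in> {1..T}"
  show "p t \<le> avg_price r p t"
    by (rule avg_price_ge) (use t assms monotone_onD[OF assms(1), of _ t] in auto)
qed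

lemma harm_le_ln:
  assumes "T \<ge> 1"
  shows "(harm T :: real) \<le> 1 + ln (real T)"
proof -
  obtain n where n: "T = Suc n" using assms by (cases T) auto
  show ?thesis
    \<comment> \<open>The decreasing sequence is \<open>harm (Suc n) - ln (Suc n)\<close>, so its
      value at index 0 is 1.\<close>
    using decseqD[OF decseq_harm_diff_ln, of 0 n] by (simp add: n harm_expand)
qed

section \<open>Existence of a maximizer\<close>

lemma total_rev_attains_max:
  assumes "0 \<le> pbar"
  shows "\<exists>p\<in>feasible T pbar. \<forall>q\<in>feasible T pbar.
    total_rev a b \<eta>p \<eta>m T q r \<le> total_rev a b \<eta>p \<eta>m T p r"
proof -
  \<comment> \<open>Tychonoff is applied with all naturals as index set; since only rounds
    \<open>1..T\<close> affect revenue, competitors are later reset to 0 elsewhere to place them in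
    \<open>?K\<close>.\<close>
  let ?K = "PiE (UNIV :: nat set) (\<lambda>_. {0..pbar})"
  have "compactin (product_topology (\<lambda>_::nat. euclideanreal) UNIV) ?K"
    by (simp add: compactin_PiE)
  then have "compact ?K"
    by (simp add: euclidean_product_topology)
  moreover have "?K \<noteq> {}" using assms by (simp add: PiE_eq_empty_iff)
  moreover have "continuous_on ?K (\<lambda>p. total_rev a b \<eta>p \<eta>m T p r)"
    unfolding total_rev_avg_price rev1_def demand_def avg_price_def divide_inverse
    by (intro continuous_intros continuous_on_subset[OF continuous_on_product_coordinates]) auto
  ultimately obtain p where p: "p \<in> ?K"
    "\<And>q. q \<in> ?K \<Longrightarrow> total_rev a b \<eta>p \<eta>m T q r \<le> total_rev a b \<eta>p \<eta>m T p r"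
    by (meson continuous_attains_sup)
  show ?thesis
  proof (intro bexI ballI)
    show "p \<in> feasible T pbar" using p(1) by (auto simp: feasible_def PiE_iff)
    fix q assume q: "q \<in> feasible T pbar"
    define q' where "q' = (\<lambda>t. if t \<in> {1..T} then q t else 0)"
    have "q' \<in> ?K" using q assms by (auto simp: q'_def feasible_def PiE_iff)
    then have "total_rev a b \<eta>p \<eta>m T q' r \<le> total_rev a b \<eta>p \<eta>m T p r" by (rule p(2))
    moreover have "total_rev a b \<eta>p \<eta>m T q' r = total_rev a b \<eta>p \<eta>m T q r"
      by (rule total_rev_cong) (simp add: q'_def)
    ultimately show "total_rev a b \<eta>p \<eta>m T q r \<le> total_rev a b \<eta>p \<eta>m T p r" by simp
  qed
qed

lemma opt_rev_eqI:
  assumes "p \<in> feasible T pbar"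
    "\<And>q. q \<in> feasible T pbar \<Longrightarrow> total_rev a b \<eta>p \<eta>m T q r \<le> total_rev a b \<eta>p \<eta>m T p r"
  shows "opt_rev a b \<eta>p \<eta>m T pbar r = total_rev a b \<eta>p \<eta>m T p r"
  unfolding opt_rev_def using assms by (intro cSup_eq_maximum) auto

section \<open>First-order conditions for loss-neutral demand\<close>

text \<open>The partial derivative of the loss-neutral revenue with respect to the price of round \<open>t\<close>.\<close>

definition grad :: "real \<Rightarrow> real \<Rightarrow> real \<Rightarrow> nat \<Rightarrow> real \<Rightarrow> (nat \<Rightarrow> real) \<Rightarrow> nat \<Rightarrow> real" where
  "grad a b \<eta> T r p t =
     b - 2 * (a + \<eta>) * p t + \<eta> * avg_price r p t + \<eta> * (\<Sum>s\<in>{t<..T}. p s / real s)"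

lemma avg_price_upd:
  assumes "t \<ge> 1"
  shows "avg_price r (p(t := p t + d)) s = avg_price r p s + (if t < s then d / real s else 0)"
proof (cases "t < s")
  case True
  then have t: "t \<in> {1..<s}" using assms by auto
  have "sum (p(t := p t + d)) ({1..<s} - {t}) = sum p ({1..<s} - {t})"
    by (rule sum.cong) auto
  then have "sum (p(t := p t + d)) {1..<s} = sum p {1..<s} + d"
    unfolding sum.remove[OF finite_atLeastLessThan t] by simp
  then show ?thesis
    using True by (simp add: avg_price_def add_divide_distrib)
next
  case False
  then have "sum (p(t := p t + d)) {1..<s} = sum p {1..<s}"
    by (intro sum.cong) auto
  then show ?thesis using False by (simp add: avg_price_def)
qed

text \<open>An exact second-order expansion: later references move linearly in \<open>d\<close>
  while the prices they multiply stay fixed, so the only quadratic term comes from round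
  \<open>t\<close> itself.\<close>

lemma total_rev_neutral_upd:
  assumes t: "t \<in> {1..T}"
  shows "total_rev a b \<eta> \<eta> T (p(t := p t + d)) r =
           total_rev a b \<eta> \<eta> T p r + d * grad a b \<eta> T r p t - (a + \<eta>) * d\<^sup>2"
proof -
  let ?q = "p(t := p t + d)"
  let ?f = "\<lambda>p s. p s * (b - (a + \<eta>) * p s + \<eta> * avg_price r p s)"
  have avg: "avg_price r ?q s = avg_price r p s + (if t < s then d / real s else 0)" for s
    using avg_price_upd t by simp
  have dec: "{1..T} = {1..<t} \<union> insert t {t<..T}" using t by auto
  have split: "sum g {1..T} = sum g {1..<t} + (g t + sum g {t<..T})" for g :: "nat \<Rightarrow> real"
    unfolding dec by (subst sum.union_disjoint) auto
  have before: "sum (?f ?q) {1..<t} = sum (?f p) {1..<t}"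
    by (rule sum.cong) (auto simp: avg)
  have "sum (?f ?q) {t<..T} = (\<Sum>s\<in>{t<..T}. ?f p s + d * \<eta> * (p s / real s))"
  proof (rule sum.cong)
    fix s assume "s \<in> {t<..T}"
    then show "?f ?q s = ?f p s + d * \<eta> * (p s / real s)"
      unfolding avg by (simp add: distrib_left distrib_right mult_ac)
  qed simp
  then have after: "sum (?f ?q) {t<..T} = sum (?f p) {t<..T} + d * \<eta> * (\<Sum>s\<in>{t<..T}. p s / real s)"
    by (simp add: sum.distrib sum_distrib_left)
  have at: "?f ?q t = ?f p t + d * (b - 2 * (a + \<eta>) * p t + \<eta> * avg_price r p t) - (a + \<eta>) * d\<^sup>2"
    unfolding avg by (simp add: power2_eq_square algebra_simps)
  show ?thesis
    unfolding total_rev_avg_price rev1_neutral split before after at grad_def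
    by (simp add: algebra_simps)
qed

lemma slope_nonpos_at_max:
  fixes g c \<delta> :: real
  assumes "0 < \<delta>" "\<And>d. 0 < d \<Longrightarrow> d \<le> \<delta> \<Longrightarrow> d * g - c * d\<^sup>2 \<le> 0"
  shows "g \<le> 0"
proof (rule ccontr)
  assume "\<not> g \<le> 0"
  \<comment> \<open>Small enough that \<open>c * d\<close> is at most \<open>g / 2\<close>, so the
    linear term wins.\<close>
  define d where "d = min \<delta> (g / (2 * (\<bar>c\<bar> + 1)))"
  have d: "0 < d" "d \<le> \<delta>" using assms(1) \<open>\<not> g \<le> 0\<close> by (auto simp: d_def)
  have "d * (g - c * d) \<le> 0" using assms(2)[OF d] by (simp add: power2_eq_square algebra_simps)
  then have "g \<le> c * d" using d by (simp add: mult_le_0_iff)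
  also have "\<dots> \<le> (\<bar>c\<bar> + 1) * (g / (2 * (\<bar>c\<bar> + 1)))"
    using d \<open>\<not> g \<le> 0\<close> by (intro mult_mono) (auto simp: d_def)
  also have "\<dots> = g / 2" by (simp add: field_simps)
  finally show False using \<open>\<not> g \<le> 0\<close> by simp
qed

text \<open>The two tail sums differ only in the entry of round \<open>Suc t\<close>, so all later
  prices cancel and a relation between neighbouring prices remains.\<close>

lemma grad_diff:
  assumes "t \<ge> 1" "Suc t \<le> T"
  shows "grad a b \<eta> T r p (Suc t) - grad a b \<eta> T r p t =
    - (2 * (a + \<eta>) + \<eta> / (real t + 1)) * (p (Suc t) - p t)
      - \<eta> * avg_price r p t / (real t + 1)"
proof -
  have "{t<..T} = insert (Suc t) {Suc t<..T}" using assms by auto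
  then have "(\<Sum>s\<in>{t<..T}. p s / real s)
      = p (Suc t) / (real t + 1) + (\<Sum>s\<in>{Suc t<..T}. p s / real s)"
    by (simp add: add.commute)
  then show ?thesis
    unfolding grad_def avg_price_Suc[OF assms(1)]
    by (simp add: diff_divide_distrib algebra_simps)
qed

section \<open>Structure of a loss-neutral maximizer\<close>

locale neutral_max =
  fixes T :: nat and pbar a b \<eta> r :: real and p :: "nat \<Rightarrow> real"
  assumes pos: "0 < pbar" "0 < a" "0 \<le> \<eta>" "0 < b" and b_less: "b < 2 * a * pbar"
    and r: "0 \<le> r" "r \<le> pbar"
    and feas: "p \<in> feasible T pbar"
    and maximal: "\<And>q. q \<in> feasible T pbar \<Longrightarrow>
      total_rev a b \<eta> \<eta> T q r \<le> total_rev a b \<eta> \<eta> T p r"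
begin

lemma price_bounds:
  assumes "t \<in> {1..T}"
  shows "0 \<le> p t" "p t \<le> pbar"
  using feas assms by (auto simp: feasible_def)

lemma ref_bounds:
  assumes "t \<in> {1..T}"
  shows "0 \<le> avg_price r p t" "avg_price r p t \<le> pbar"
  using r assms by (auto intro!: avg_price_nonneg avg_price_le price_bounds)

lemma variation_nonpos:
  assumes "t \<in> {1..T}" "0 \<le> p t + d" "p t + d \<le> pbar"
  shows "d * grad a b \<eta> T r p t - (a + \<eta>) * d\<^sup>2 \<le> 0"
proof -
  have "p(t := p t + d) \<in> feasible T pbar"
    using feas assms by (auto simp: feasible_def)
  from maximal[OF this] show ?thesis
    using total_rev_neutral_upd[OF assms(1)] by simp
qed

lemma grad_nonpos:
  assumes "t \<in> {1..T}" "p t < pbar"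
  shows "grad a b \<eta> T r p t \<le> 0"
proof (rule slope_nonpos_at_max[where \<delta> = "pbar - p t" and c = "a + \<eta>"])
  fix d assume "0 < d" "d \<le> pbar - p t"
  then show "d * grad a b \<eta> T r p t - (a + \<eta>) * d\<^sup>2 \<le> 0"
    using assms(1) price_bounds[OF assms(1)] by (intro variation_nonpos) auto
qed (use assms in simp)

text \<open>At price 0 the derivative is at least \<open>b > 0\<close>, yet raising the price must
  not pay.\<close>

lemma price_pos:
  assumes t: "t \<in> {1..T}"
  shows "0 < p t"
proof (rule ccontr)
  assume "\<not> 0 < p t"
  then have zero: "p t = 0" using price_bounds[OF t] by simp
  have "0 \<le> (\<Sum>s\<in>{t<..T}. p s / real s)"
    using t by (intro sum_nonneg divide_nonneg_nonneg price_bounds) auto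
  then have "b \<le> grad a b \<eta> T r p t"
    unfolding grad_def using zero ref_bounds(1)[OF t] pos by simp
  moreover have "grad a b \<eta> T r p t \<le> 0" using grad_nonpos[OF t] zero pos by simp
  ultimately show False using pos by simp
qed

text \<open>Every price is positive, so a small decrease is feasible in every round and cannot
  pay.\<close>

lemma grad_nonneg:
  assumes "t \<in> {1..T}"
  shows "0 \<le> grad a b \<eta> T r p t"
proof -
  have "d * - grad a b \<eta> T r p t - (a + \<eta>) * d\<^sup>2 \<le> 0" if "0 < d" "d \<le> p t" for d
    using variation_nonpos[OF assms, of "- d"] that price_bounds[OF assms] by simp
  from slope_nonpos_at_max[OF price_pos[OF assms] this] show ?thesis by simp
qed

lemma grad_eq_0:
  assumes "t \<in> {1..T}" "p t < pbar"
  shows "grad a b \<eta> T r p t = 0"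
  using grad_nonneg grad_nonpos assms by (simp add: order_antisym)

text \<open>If \<open>p t\<close> is below \<open>pbar\<close>, the derivative is 0 at
  \<open>t\<close> and nonnegative at \<open>Suc t\<close>, and \<open>grad_diff\<close> then bounds
  the increment above by a nonpositive number. At \<open>pbar\<close> nothing is to be
  shown.\<close>

lemma decreasing_step:
  assumes "t \<ge> 1" "Suc t \<le> T"
  shows "p (Suc t) \<le> p t"
proof (cases "p t < pbar")
  case True
  let ?k = "2 * (a + \<eta>) + \<eta> / (real t + 1)"
  have k: "?k > 0" using pos by (intro add_pos_nonneg) auto
  have "0 \<le> \<eta> * avg_price r p t / (real t + 1)"
    using ref_bounds[of t] assms pos by simp
  moreover have "0 \<le> - ?k * (p (Suc t) - p t) - \<eta> * avg_price r p t / (real t + 1)"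
    using grad_diff[OF assms, of a b \<eta> r p] grad_eq_0[of t] True grad_nonneg[of "Suc t"] assms by simp
  ultimately have "?k * (p (Suc t) - p t) \<le> 0" by linarith
  then show ?thesis using k by (simp add: mult_le_0_iff)
next
  case False
  then show ?thesis using price_bounds[of "Suc t"] assms by simp
qed

lemma decreasing: "antimono_on {1..T} p"
proof (rule monotone_onI)
  fix s t assume "s \<in> {1..T}" "t \<in> {1..T}" "s \<le> t"
  from this(3,1,2) show "p t \<le> p s"
  proof (induction rule: dec_induct)
    case (step n)
    then show ?case using decreasing_step[of n] by auto
  qed simp
qed

lemma recurrence:
  assumes "t \<ge> 1" "Suc t \<le> T" "p t < pbar"
  shows "p (Suc t) = p t - \<eta> * avg_price r p t / (2 * (a + \<eta>) * real (Suc t) + \<eta>)"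
proof -
  have "p (Suc t) < pbar" using decreasing_step[OF assms(1,2)] assms(3) by simp
  then have "grad a b \<eta> T r p (Suc t) = 0" "grad a b \<eta> T r p t = 0"
    using assms by (auto intro!: grad_eq_0)
  then have "(2 * (a + \<eta>) + \<eta> / (real t + 1)) * (p (Suc t) - p t) = - \<eta> * avg_price r p t / (real t + 1)"
    using grad_diff[OF assms(1,2), of a b \<eta> r p] by (simp add: algebra_simps)
  \<comment> \<open>Clearing \<open>t + 1\<close> turns the coefficient into the denominator of the
    curve formula.\<close>
  then have "((2 * (a + \<eta>) + \<eta> / (real t + 1)) * (real t + 1)) * (p (Suc t) - p t) = - \<eta> * avg_price r p t"
    by (simp add: nonzero_eq_divide_eq mult_ac)
  moreover have "(2 * (a + \<eta>) + \<eta> / (real t + 1)) * (real t + 1) = 2 * (a + \<eta>) * real (Suc t) + \<eta>"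
    by (simp add: distrib_right add.commute)
  ultimately have "(2 * (a + \<eta>) * real (Suc t) + \<eta>) * (p (Suc t) - p t) = - \<eta> * avg_price r p t"
    by simp
  moreover have "2 * (a + \<eta>) * real (Suc t) + \<eta> > 0"
    using pos by (intro add_pos_nonneg) auto
  ultimately show ?thesis by (simp add: field_simps)
qed

text \<open>The last round influences no later reference, so at \<open>pbar\<close> its derivative
  would be at most \<open>b - 2 * a * pbar - \<eta> * pbar < 0\<close>.\<close>

lemma final_price_less: "T \<ge> 1 \<Longrightarrow> p T < pbar"
proof (rule ccontr)
  assume T: "T \<ge> 1" and "\<not> p T < pbar"
  then have eq: "p T = pbar" using price_bounds[of T] by simp
  have "\<eta> * avg_price r p T \<le> \<eta> * pbar"
    using ref_bounds[of T] T pos by (intro mult_left_mono) auto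
  moreover have "0 \<le> b - 2 * (a + \<eta>) * pbar + \<eta> * avg_price r p T"
    using grad_nonneg[of T] T eq by (simp add: grad_def)
  moreover have "0 \<le> \<eta> * pbar" using pos by simp
  ultimately show False using b_less by (simp add: algebra_simps)
qed

lemma final_price:
  assumes "T \<ge> 1"
  shows "p T = (\<eta> * avg_price r p T + b) / (2 * (a + \<eta>))"
proof -
  have "b - 2 * (a + \<eta>) * p T + \<eta> * avg_price r p T = 0"
    using grad_eq_0[of T] final_price_less assms by (simp add: grad_def)
  moreover have "2 * (a + \<eta>) > 0" using pos by simp
  ultimately show ?thesis by (simp add: field_simps)
qed

section \<open>Identification of the maximizer with the price curve\<close>

definition td :: nat where "td = (LEAST t. t \<ge> 1 \<and> p t < pbar)"

lemma td_props:
  assumes "T \<ge> 1"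
  shows "td \<in> {1..T}" "p td < pbar" "\<And>t. t \<ge> 1 \<Longrightarrow> t < td \<Longrightarrow> t \<le> T \<Longrightarrow> p t = pbar"
proof -
  have T: "T \<ge> 1 \<and> p T < pbar" using assms final_price_less by simp
  have "td \<ge> 1 \<and> p td < pbar" unfolding td_def by (rule LeastI[of _ T]) (rule T)
  moreover have "td \<le> T" unfolding td_def by (rule Least_le) (rule T)
  ultimately show "td \<in> {1..T}" "p td < pbar" by auto
  fix t assume "t \<ge> 1" "t < td" "t \<le> T"
  then have "\<not> p t < pbar" unfolding td_def using not_less_Least by blast
  then show "p t = pbar" using price_bounds[of t] \<open>t \<ge> 1\<close> \<open>t \<le> T\<close> by simp
qed

lemma price_curve_eq:
  assumes "t \<in> {1..T}"
  shows "price_curve T pbar a b \<eta> td (p td) r t = p t"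
  using assms
proof (induction t rule: less_induct)
  case (less t)
  have T: "T \<ge> 1" using less.prems by simp
  note td = td_props[OF T]
  let ?c = "price_curve T pbar a b \<eta> td (p td) r"
  \<comment> \<open>An average at \<open>s\<close> reads only rounds before \<open>s\<close>, so the
    induction hypothesis covers even \<open>s = t\<close>, which the last-round branch
    needs.\<close>
  have avg: "avg_price r ?c s = avg_price r p s" if "s \<le> t" for s
    using that less by (intro avg_price_cong) auto
  consider "t < td" | "t = td" | "t > td" "t < T" | "t > td" "t = T"
    using less.prems by force
  then show ?case
  proof cases
    case 1
    then show ?thesis using td(3)[of t] less.prems by (simp add: price_curve.simps)
  next
    case 2
    then show ?thesis by (simp add: price_curve.simps)
  next
    case 3
    then obtain s where s: "t = Suc s" by (cases t) auto
    have "s \<ge> 1" "s \<le> T" "td \<le> s" using 3 s td(1) by auto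
    moreover from this have "p s \<le> p td"
      using monotone_onD[OF decreasing, of td s] td(1) by auto
    ultimately have "p t = p s - \<eta> * avg_price r p s / (2 * (a + \<eta>) * real t + \<eta>)"
      using recurrence[of s] td(2) 3 s by simp
    moreover have "?c s = p s" using less.IH[of s] s \<open>s \<ge> 1\<close> \<open>s \<le> T\<close> by simp
    ultimately show ?thesis
      using 3 s avg[of s] price_curve.simps[of T pbar a b \<eta> td "p td" r t] by simp
  next
    case 4
    then show ?thesis
      using avg[of t] final_price[OF T] price_curve.simps[of T pbar a b \<eta> td "p td" r t] by simp
  qed
qed

text \<open>The last-round optimality condition holds wherever \<open>td\<close> falls, in
  particular when \<open>td = T\<close>.\<close>

lemma curve_consistent:
  assumes "T \<ge> 1"
  shows "curve_consistent T pbar a b \<eta> td (p td) r"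
proof -
  have "avg_price r (price_curve T pbar a b \<eta> td (p td) r) T = avg_price r p T"
    by (intro avg_price_cong price_curve_eq) auto
  then show ?thesis
    unfolding curve_consistent_def using final_price[OF assms] by metis
qed

end

section \<open>Markdown policies under gain-seeking demand\<close>

text \<open>Here \<open>x < y\<close> are two consecutive prices, quoted at references \<open>r\<close> and \<open>r + w (x - r)\<close>; the
  swapped prices are quoted at references \<open>r\<close> and \<open>r + w (y - r)\<close>.\<close>

lemma rev1_swap_le:
  assumes "0 \<le> x" "x < y" "0 \<le> r" "0 \<le> w" "w \<le> 1" "0 \<le> \<eta>m" "\<eta>m \<le> \<eta>p"
  shows "rev1 a b \<eta>p \<eta>m x r + rev1 a b \<eta>p \<eta>m y (r + w * (x - r))
    \<le> rev1 a b \<eta>p \<eta>m y r + rev1 a b \<eta>p \<eta>m x (r + w * (y - r))"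
proof -
  \<comment> \<open>The reference effect as a piecewise linear function with slope
    \<open>\<eta>m\<close> on losses and \<open>\<eta>p\<close> on gains; all its slopes are at
    least \<open>\<eta>m\<close>.\<close>
  define g where "g z = \<eta>p * max z 0 - \<eta>m * max (- z) 0" for z :: real
  have rev: "rev1 a b \<eta>p \<eta>m p s = p * (b - a * p) + p * g (s - p)" for p s
    unfolding rev1_def demand_def g_def by (simp add: algebra_simps)
  have g_pos: "g z = \<eta>p * z" if "z \<ge> 0" for z using that by (simp add: g_def)
  have g_neg: "g z = \<eta>m * z" if "z \<le> 0" for z using that by (simp add: g_def max_def)
  have g_mono: "g z \<le> g z'" if "z \<le> z'" for z z'
    unfolding g_def using that assms by (intro diff_mono mult_left_mono) auto
  have g_ge_m: "g z' - g z \<ge> \<eta>m * (z' - z)" if "z \<le> z'" for z z'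
  proof -
    have "g z = \<eta>m * z + (\<eta>p - \<eta>m) * max z 0" for z
      by (simp add: g_def max_def algebra_simps)
    then have "g z' - g z - \<eta>m * (z' - z) = (\<eta>p - \<eta>m) * max z' 0 - (\<eta>p - \<eta>m) * max z 0"
      by (simp add: right_diff_distrib)
    moreover have "(\<eta>p - \<eta>m) * max z 0 \<le> (\<eta>p - \<eta>m) * max z' 0"
      using that assms by (intro mult_left_mono) auto
    ultimately show ?thesis by linarith
  qed
  \<comment> \<open>The base revenues cancel, so the claim is \<open>y * ?sy \<le> x * ?sx\<close>:
    these are the changes in reference effect that each price undergoes when it is charged second.
    The cases locate \<open>r\<close> relative to \<open>x\<close> and \<open>y\<close>.\<close>
  let ?sx = "g (r + w * (y - r) - x) - g (r - x)"
  let ?sy = "g (r + w * (x - r) - y) - g (r - y)"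
  have "y * ?sy \<le> x * ?sx"
  proof (cases "r \<le> x")
    case True
    \<comment> \<open>Since \<open>w \<le> 1\<close>, the moved reference stays at most
      \<open>x\<close>, hence below \<open>y\<close>, and \<open>?sy\<close> has slope
      \<open>\<eta>m\<close> throughout.\<close>
    have "w * (x - r) \<le> 1 * (x - r)" using True assms by (intro mult_right_mono) auto
    then have "?sy = \<eta>m * (w * (x - r))"
      using True assms by (simp add: g_neg algebra_simps)
    moreover have "\<eta>m * (w * (y - r)) \<le> ?sx"
      using g_ge_m[of "r - x" "r + w * (y - r) - x"] True assms by simp
    moreover have "y * (\<eta>m * (w * (x - r))) \<le> x * (\<eta>m * (w * (y - r)))"
    proof -
      have "0 \<le> \<eta>m * w * r * (y - x)" using assms by simp
      then show ?thesis by (simp add: algebra_simps)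
    qed
    ultimately show ?thesis using mult_left_mono[of _ ?sx x] assms by fastforce
  next
    case False
    have wx: "0 \<le> w * (r - x)" using False assms by simp
    show ?thesis
    proof (cases "r < y")
      case True
      \<comment> \<open>With \<open>r\<close> between the prices, charging \<open>y\<close> first
        raises the reference and charging \<open>x\<close> first lowers it, so signs decide.\<close>
      have "w * (r - y) \<le> 0" using True assms by (simp add: mult_nonneg_nonpos)
      then have "0 \<le> ?sx" "?sy \<le> 0"
        using wx by (auto intro!: g_mono simp: algebra_simps)
      then show ?thesis
        using assms mult_nonneg_nonneg[of x ?sx] mult_nonneg_nonpos[of y ?sy] by linarith
    next
      case yr: False
      \<comment> \<open>The reference moved towards \<open>y\<close> stays at least
        \<open>y > x\<close>, so \<open>?sx\<close> has slope \<open>\<eta>p\<close>. What remains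
        is whether the reference moved towards \<open>x\<close> drops below
        \<open>y\<close>.\<close>
      have "w * (r - y) \<le> 1 * (r - y)" using yr assms by (intro mult_right_mono) auto
      then have sx: "?sx = - \<eta>p * w * (r - y)"
        using yr False assms by (simp add: g_pos algebra_simps)
      show ?thesis
      proof (cases "0 \<le> r + w * (x - r) - y")
        case True
        then have sy: "?sy = - \<eta>p * w * (r - x)" using yr by (simp add: g_pos algebra_simps)
        have "0 \<le> \<eta>p * w * r * (y - x)" using assms by simp
        then show ?thesis unfolding sx sy by (simp add: algebra_simps)
      next
        case crossing: False
        \<comment> \<open>After crossing, the second-round effect on \<open>y\<close> is at most 0,
          so \<open>?sy\<close> is bounded by losing the whole gain
          \<open>\<eta>p * (r - y)\<close>.\<close>
        have "g (r + w * (x - r) - y) \<le> 0"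
          using crossing g_mono[of "r + w * (x - r) - y" 0] by (simp add: g_pos)
        then have "?sy \<le> - \<eta>p * (r - y)" using yr by (simp add: g_pos)
        then have "y * ?sy \<le> y * (- \<eta>p * (r - y))" using assms by (intro mult_left_mono) auto
        moreover have "y * (- \<eta>p * (r - y)) \<le> x * (- \<eta>p * w * (r - y))"
        proof -
          have "x * w \<le> y * 1" using assms by (intro mult_mono) auto
          then have "0 \<le> \<eta>p * (r - y) * (y - x * w)" using assms yr by simp
          then show ?thesis by (simp add: algebra_simps)
        qed
        ultimately show ?thesis unfolding sx by linarith
      qed
    qed
  qed
  then show ?thesis unfolding rev by (simp add: algebra_simps)
qed

lemma sum_split_adjacent:
  fixes g :: "nat \<Rightarrow> 'a::comm_monoid_add"
  assumes "1 \<le> t" "Suc t \<le> T"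
  shows "sum g {1..T} = g t + g (Suc t) + sum g ({1..T} - {t, Suc t})"
proof -
  have "sum g {1..T} = sum g ({1..T} - {t, Suc t}) + sum g {t, Suc t}"
    by (rule sum.subset_diff) (use assms in auto)
  then show ?thesis by (simp add: add.commute)
qed

text \<open>The swap alters the reference of round \<open>Suc t\<close> only, so the two-round
  inequality suffices.\<close>

lemma total_rev_swap_le:
  assumes t: "1 \<le> t" "Suc t \<le> T" and p: "p \<in> feasible T pbar" and inc: "p t < p (Suc t)"
    and "0 \<le> r" "0 \<le> \<eta>m" "\<eta>m \<le> \<eta>p"
  shows "total_rev a b \<eta>p \<eta>m T p r \<le> total_rev a b \<eta>p \<eta>m T (p \<circ> Transposition.transpose t (Suc t)) r"
proof -
  let ?q = "p \<circ> Transposition.transpose t (Suc t)"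
  have other: "?q s = p s" if "s \<noteq> t" "s \<noteq> Suc t" for s using that by simp
  have avg: "avg_price r ?q s = avg_price r p s" if "s \<noteq> Suc t" for s
  proof (cases "s \<le> t")
    case True
    then show ?thesis by (intro avg_price_cong) (auto simp: other)
  next
    case False
    \<comment> \<open>Here \<open>s\<close> exceeds \<open>Suc t\<close>, so both swapped rounds
      enter the same sum.\<close>
    then have "Transposition.transpose t (Suc t) permutes {1..<s}"
      using t that by (intro permutes_swap_id) auto
    from sum.permute[OF this, of p] show ?thesis by (simp add: avg_price_def)
  qed
  let ?r = "avg_price r p t" and ?w = "1 / (real t + 1)"
  let ?f = "\<lambda>p s. rev1 a b \<eta>p \<eta>m (p s) (avg_price r p s)"
  have ref: "avg_price r p (Suc t) = ?r + ?w * (p t - ?r)"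
    "avg_price r ?q (Suc t) = ?r + ?w * (p (Suc t) - ?r)"
    using t by (simp_all add: avg_price_Suc avg)
  have nonneg: "0 \<le> p s" if "s \<in> {1..T}" for s using p that by (auto simp: feasible_def)
  then have "0 \<le> ?r" using t \<open>0 \<le> r\<close> by (intro avg_price_nonneg) auto
  then have "?f p t + ?f p (Suc t) \<le> ?f ?q t + ?f ?q (Suc t)"
    unfolding ref avg[of t, simplified]
    using rev1_swap_le[of "p t" "p (Suc t)" ?r ?w \<eta>m \<eta>p a b] assms nonneg[of t] by simp
  moreover have "sum (?f ?q) ({1..T} - {t, Suc t}) = sum (?f p) ({1..T} - {t, Suc t})"
    by (rule sum.cong) (auto simp: avg)
  ultimately show ?thesis
    unfolding total_rev_avg_price sum_split_adjacent[OF t] by simp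
qed

text \<open>Among the rearrangements of \<open>p\<close> with the largest revenue, one that minimizes
  \<open>\<Sum>t. t * q t\<close> is decreasing, since swapping an ascent would lower that sum.\<close>

lemma markdown_rearrangement:
  assumes p: "p \<in> feasible T pbar" and "0 \<le> r" "0 \<le> \<eta>m" "\<eta>m \<le> \<eta>p"
  obtains q where "q \<in> feasible T pbar" "antimono_on {1..T} q"
    "total_rev a b \<eta>p \<eta>m T p r \<le> total_rev a b \<eta>p \<eta>m T q r"
proof -
  let ?V = "\<lambda>q. total_rev a b \<eta>p \<eta>m T q r"
  define A where "A = (\<lambda>\<pi>. p \<circ> \<pi>) ` {\<pi>. \<pi> permutes {1..T}}"
  have A: "finite A" "p \<in> A"
    unfolding A_def using permutes_id by (auto intro!: finite_permutations image_eqI[of _ _ id])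
  define B where "B = {q \<in> A. ?V q = Max (?V ` A)}"
  have "Max (?V ` A) \<in> ?V ` A" using A by (intro Max_in) auto
  then have B: "finite B" "B \<noteq> {}" using A by (auto simp: B_def)
  define q where "q = arg_min_on (\<lambda>q. \<Sum>t = 1..T. real t * q t) B"
  have q: "q \<in> B" unfolding q_def by (rule arg_min_if_finite(1)[OF B])
  have V_le: "?V q' \<le> ?V q" if "q' \<in> A" for q'
    using q A that by (auto simp: B_def)
  have feas: "q' \<in> feasible T pbar" if "q' \<in> A" for q'
    using that p unfolding A_def feasible_def by (auto simp: Pi_iff permutes_in_image simp del: atLeastAtMost_iff)
  have no_ascent: "q (Suc t) \<le> q t" if t: "1 \<le> t" "Suc t \<le> T" for t
  proof (rule ccontr)
    assume "\<not> q (Suc t) \<le> q t"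
    let ?q = "q \<circ> Transposition.transpose t (Suc t)"
    obtain \<pi> where \<pi>: "q = p \<circ> \<pi>" "\<pi> permutes {1..T}" using q by (auto simp: B_def A_def)
    have "Transposition.transpose t (Suc t) permutes {1..T}" using t by (intro permutes_swap_id) auto
    then have "?q \<in> A" using \<pi> by (auto simp: A_def o_assoc [symmetric] intro!: imageI permutes_compose)
    moreover have "?V q \<le> ?V ?q"
      using t q assms \<open>\<not> q (Suc t) \<le> q t\<close>
      by (intro total_rev_swap_le[where pbar = pbar] feas) (auto simp: B_def)
    \<comment> \<open>The swap stays among the best rearrangements, so minimality of the weighted
      sum applies; yet that sum changes by \<open>q t - q (Suc t) < 0\<close>.\<close>
    ultimately have "?q \<in> B" using V_le q by (fastforce simp: B_def)
    then have "(\<Sum>t = 1..T. real t * q t) \<le> (\<Sum>t = 1..T. real t * ?q t)"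
      unfolding q_def by (rule arg_min_least[OF B])
    moreover have "(\<Sum>s\<in>{1..T} - {t, Suc t}. real s * ?q s) = (\<Sum>s\<in>{1..T} - {t, Suc t}. real s * q s)"
      by (rule sum.cong) auto
    ultimately show False
      unfolding sum_split_adjacent[OF t] using \<open>\<not> q (Suc t) \<le> q t\<close> by (simp add: algebra_simps)
  qed
  have "antimono_on {1..T} q"
  proof (rule monotone_onI)
    fix s t assume "s \<in> {1..T}" "t \<in> {1..T}" "s \<le> t"
    from this(3,1,2) show "q t \<le> q s"
    proof (induction rule: dec_induct)
      case (step n)
      then show ?case using no_ascent[of n] by auto
    qed simp
  qed
  then show thesis using that[of q] feas q V_le[OF A(2)] by (auto simp: B_def)
qed

section \<open>Comparison with the optimum under asymmetric reference effects\<close>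

context neutral_max
begin

lemma total_rev_le_neutral_max:
  assumes "r = pbar" "q \<in> feasible T pbar" "0 \<le> \<eta>m" "0 \<le> r'" "r' \<le> pbar"
  shows "total_rev a b \<eta> \<eta>m T q r' \<le> total_rev a b \<eta> \<eta> T p pbar"
proof -
  have "total_rev a b \<eta> \<eta>m T q r' \<le> total_rev a b \<eta> \<eta>m T q pbar"
    using assms pos by (intro total_rev_mono_ref) auto
  also have "\<dots> \<le> total_rev a b \<eta> \<eta> T p pbar"
  proof (cases "\<eta> \<le> \<eta>m")
    case True
    then have "total_rev a b \<eta> \<eta>m T q pbar \<le> total_rev a b \<eta> \<eta> T q pbar"
      unfolding total_rev_def using assms(2)
      by (intro sum_mono rev1_le_neutral) (auto simp: feasible_def)
    then show ?thesis using maximal[OF assms(2)] assms(1) by simp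
  next
    case False
    then obtain q' where q': "q' \<in> feasible T pbar" "antimono_on {1..T} q'"
      "total_rev a b \<eta> \<eta>m T q pbar \<le> total_rev a b \<eta> \<eta>m T q' pbar"
      using markdown_rearrangement[OF assms(2), of pbar \<eta>m \<eta> a b] assms pos by auto
    have "total_rev a b \<eta> \<eta>m T q' pbar = total_rev a b \<eta> \<eta> T q' pbar"
      using q' by (intro total_rev_markdown) (auto simp: feasible_def)
    then show ?thesis using q' maximal[of q'] assms(1) by simp
  qed
  finally show ?thesis .
qed

text \<open>The maximizer is decreasing and starts at most at \<open>pbar\<close>, so its
  loss-neutral value at \<open>pbar\<close>, which bounds the optimum, is also its true revenue
  there. Only the cost of starting at \<open>r'\<close> remains.\<close>

lemma near_optimal:
  assumes "r = pbar" "0 \<le> \<eta>m" "0 \<le> r'" "r' \<le> pbar"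
  shows "opt_rev a b \<eta> \<eta>m T pbar r' - total_rev a b \<eta> \<eta>m T p r' \<le> pbar\<^sup>2 * (\<eta> + \<eta>m) * harm T"
proof -
  have "opt_rev a b \<eta> \<eta>m T pbar r' \<le> total_rev a b \<eta> \<eta> T p pbar"
    unfolding opt_rev_def using feas assms
    by (intro cSUP_least total_rev_le_neutral_max) auto
  also have "\<dots> = total_rev a b \<eta> \<eta>m T p pbar"
    using decreasing price_bounds by (intro total_rev_markdown [symmetric]) auto
  finally show ?thesis
    using total_rev_lipschitz_ref[OF feas, of \<eta> \<eta>m r' a b] assms pos by simp
qed

end

section \<open>The price curve\<close>

text \<open>A choice made from these arguments alone, so that the round and price read off from it
  cannot depend on \<open>\<eta>m\<close>.\<close>

definition neutral_opt :: "nat \<Rightarrow> real \<Rightarrow> real \<Rightarrow> real \<Rightarrow> real \<Rightarrow> real \<Rightarrow> nat \<Rightarrow> real" where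
  "neutral_opt T pbar a b \<eta> r = (SOME p. p \<in> feasible T pbar \<and>
     (\<forall>q\<in>feasible T pbar. total_rev a b \<eta> \<eta> T q r \<le> total_rev a b \<eta> \<eta> T p r))"

lemma neutral_max_neutral_opt:
  assumes "standing_assms pbar c0 a b \<eta> \<eta>m" "r \<in> {0..pbar}"
  shows "neutral_max T pbar a b \<eta> r (neutral_opt T pbar a b \<eta> r)"
proof -
  have pos: "0 < pbar" "0 < c0" "0 < a" "0 \<le> \<eta>" "0 < b / (2 * a)" "b / (2 * a) \<le> pbar - c0"
    using assms(1) unfolding standing_assms_def by blast+
  have "0 < b" using pos(3,5) by (simp add: zero_less_divide_iff)
  moreover have "b / (2 * a) < pbar" using pos by simp
  then have "b < 2 * a * pbar" using pos(3) by (simp add: field_simps)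
  moreover have "\<exists>p. p \<in> feasible T pbar \<and>
     (\<forall>q\<in>feasible T pbar. total_rev a b \<eta> \<eta> T q r \<le> total_rev a b \<eta> \<eta> T p r)"
    using total_rev_attains_max[of pbar T a b \<eta> \<eta> r] pos(1) by auto
  note someI_ex[OF this, folded neutral_opt_def]
  ultimately show ?thesis
    using pos(1,3,4) assms(2) by unfold_locales auto
qed

theorem proposition2:
  shows "\<exists>(tdag :: nat \<Rightarrow> real \<Rightarrow> real \<Rightarrow> real \<Rightarrow> real \<Rightarrow> real \<Rightarrow> nat)
           (pdag :: nat \<Rightarrow> real \<Rightarrow> real \<Rightarrow> real \<Rightarrow> real \<Rightarrow> real \<Rightarrow> real).
    \<forall>pbar c0 a b \<eta>p \<eta>m. standing_assms pbar c0 a b \<eta>p \<eta>m \<longrightarrow>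
      (let curve = (\<lambda>T r. price_curve T pbar a b \<eta>p
                           (tdag T pbar a b \<eta>p r) (pdag T pbar a b \<eta>p r) r)
       in (\<forall>T\<ge>1. \<forall>r\<in>{0..pbar}.
             tdag T pbar a b \<eta>p r \<in> {1..T} \<and>
             pdag T pbar a b \<eta>p r \<in> {0..pbar} \<and>
             curve_consistent T pbar a b \<eta>p
               (tdag T pbar a b \<eta>p r) (pdag T pbar a b \<eta>p r) r) \<and>
          (\<eta>p = \<eta>m \<longrightarrow>
             (\<forall>T\<ge>1. \<forall>r\<in>{0..pbar}.
                curve T r \<in> feasible T pbar \<and>
                opt_rev a b \<eta>p \<eta>m T pbar r = total_rev a b \<eta>p \<eta>m T (curve T r) r)) \<and>
          (\<eta>p \<noteq> \<eta>m \<longrightarrow>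
             (\<exists>C. \<forall>T\<ge>2. curve T pbar \<in> feasible T pbar \<and>
                (\<forall>r\<in>{0..pbar}.
                   opt_rev a b \<eta>p \<eta>m T pbar r - total_rev a b \<eta>p \<eta>m T (curve T pbar) r
                     \<le> C * ln (real T)))))"
proof -
  \<comment> \<open>The expression behind \<open>td\<close>, stated before any instance is fixed so
    that the witnesses are uniform over instances.\<close>
  define tdag where "tdag T pbar a b \<eta> r = (LEAST t. t \<ge> 1 \<and> neutral_opt T pbar a b \<eta> r t < pbar)"
    for T :: nat and pbar a b \<eta> r :: real
  define pdag where "pdag T pbar a b \<eta> r = neutral_opt T pbar a b \<eta> r (tdag T pbar a b \<eta> r)"
    for T :: nat and pbar a b \<eta> r :: real
  show ?thesis
  proof (rule exI[of _ tdag], rule exI[of _ pdag], intro allI impI)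
    fix pbar c0 a b \<eta>p \<eta>m :: real
    assume sa: "standing_assms pbar c0 a b \<eta>p \<eta>m"
    then have pos: "0 < pbar" "0 \<le> \<eta>p" "0 \<le> \<eta>m" by (auto simp: standing_assms_def)
    define curve where "curve = (\<lambda>T r. price_curve T pbar a b \<eta>p
                           (tdag T pbar a b \<eta>p r) (pdag T pbar a b \<eta>p r) r)"
    let ?p = "\<lambda>T r. neutral_opt T pbar a b \<eta>p r"
    have nm: "neutral_max T pbar a b \<eta>p r (?p T r)" if "r \<in> {0..pbar}" for T r
      by (rule neutral_max_neutral_opt[OF sa that])
    have td: "neutral_max.td pbar (?p T r) = tdag T pbar a b \<eta>p r" if "r \<in> {0..pbar}" for T r
      by (simp add: neutral_max.td_def[OF nm[OF that]] tdag_def)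
    have eq: "curve T r t = ?p T r t" if "r \<in> {0..pbar}" "t \<in> {1..T}" for T r t
      using neutral_max.price_curve_eq[OF nm[OF that(1)] that(2)] td[OF that(1)]
      by (simp add: curve_def pdag_def)
    have feas: "curve T r \<in> feasible T pbar" if "r \<in> {0..pbar}" for T r
      using neutral_max.feas[OF nm[OF that], of T] eq[OF that]
      by (simp add: feasible_def Pi_def)
    have rev: "total_rev a b \<eta>p e T (curve T r) r' = total_rev a b \<eta>p e T (?p T r) r'"
      if "r \<in> {0..pbar}" for e T r r'
      by (rule total_rev_cong) (rule eq[OF that])
    have "tdag T pbar a b \<eta>p r \<in> {1..T} \<and> pdag T pbar a b \<eta>p r \<in> {0..pbar} \<and>
        curve_consistent T pbar a b \<eta>p (tdag T pbar a b \<eta>p r) (pdag T pbar a b \<eta>p r) r"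
      if T: "T \<ge> 1" and r: "r \<in> {0..pbar}" for T r
      using neutral_max.td_props(1)[OF nm[OF r] T] neutral_max.curve_consistent[OF nm[OF r] T]
        neutral_max.price_bounds[OF nm[OF r], of "tdag T pbar a b \<eta>p r" T]
      by (simp add: td[OF r] pdag_def)
    moreover have "curve T r \<in> feasible T pbar \<and>
        opt_rev a b \<eta>p \<eta>m T pbar r = total_rev a b \<eta>p \<eta>m T (curve T r) r"
      if "\<eta>p = \<eta>m" and r: "r \<in> {0..pbar}" for T r
      using feas[OF r, of T] neutral_max.maximal[OF nm[OF r], of _ T] rev[OF r, of \<eta>p T r] that(1)
      by (intro conjI opt_rev_eqI) simp_all
    moreover have "\<exists>C. \<forall>T\<ge>2. curve T pbar \<in> feasible T pbar \<and>
        (\<forall>r\<in>{0..pbar}. opt_rev a b \<eta>p \<eta>m T pbar r - total_rev a b \<eta>p \<eta>m T (curve T pbar) r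
           \<le> C * ln (real T))"
    proof (intro exI allI impI conjI ballI feas)
      show "pbar \<in> {0..pbar}" using pos by simp
      then have pbar: "pbar \<in> {0..pbar}" .
      fix T :: nat and r assume T: "T \<ge> 2" and r: "r \<in> {0..pbar}"
      let ?K = "pbar\<^sup>2 * (\<eta>p + \<eta>m)"
      have "ln 2 \<le> ln (real T)" using T by simp
      \<comment> \<open>For \<open>T \<ge> 2\<close> the additive 1 is at most
        \<open>ln T / ln 2\<close>, which gives the constant.\<close>
      then have "1 + ln (real T) \<le> (1 / ln 2 + 1) * ln (real T)" by (simp add: field_simps)
      then have "harm T \<le> (1 / ln 2 + 1) * ln (real T)"
        using harm_le_ln[of T] T by simp
      then have "?K * harm T \<le> ?K * ((1 / ln 2 + 1) * ln (real T))"
        using pos by (intro mult_left_mono) auto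
      moreover have "opt_rev a b \<eta>p \<eta>m T pbar r - total_rev a b \<eta>p \<eta>m T (curve T pbar) r
          \<le> ?K * harm T"
        using neutral_max.near_optimal[OF nm[OF pbar] refl pos(3)] r by (simp add: rev[OF pbar])
      ultimately show "opt_rev a b \<eta>p \<eta>m T pbar r - total_rev a b \<eta>p \<eta>m T (curve T pbar) r
          \<le> (?K * (1 / ln 2 + 1)) * ln (real T)"
        by (simp add: mult.assoc)
    qed
    ultimately show "let curve = (\<lambda>T r. price_curve T pbar a b \<eta>p
                           (tdag T pbar a b \<eta>p r) (pdag T pbar a b \<eta>p r) r)
       in (\<forall>T\<ge>1. \<forall>r\<in>{0..pbar}.
             tdag T pbar a b \<eta>p r \<in> {1..T} \<and>
             pdag T pbar a b \<eta>p r \<in> {0..pbar} \<and>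
             curve_consistent T pbar a b \<eta>p
               (tdag T pbar a b \<eta>p r) (pdag T pbar a b \<eta>p r) r) \<and>
          (\<eta>p = \<eta>m \<longrightarrow>
             (\<forall>T\<ge>1. \<forall>r\<in>{0..pbar}.
                curve T r \<in> feasible T pbar \<and>
                opt_rev a b \<eta>p \<eta>m T pbar r = total_rev a b \<eta>p \<eta>m T (curve T r) r)) \<and>
          (\<eta>p \<noteq> \<eta>m \<longrightarrow>
             (\<exists>C. \<forall>T\<ge>2. curve T pbar \<in> feasible T pbar \<and>
                (\<forall>r\<in>{0..pbar}.
                   opt_rev a b \<eta>p \<eta>m T pbar r - total_rev a b \<eta>p \<eta>m T (curve T pbar) r
                     \<le> C * ln (real T))))"
      unfolding Let_def curve_def [symmetric] by blast
  qed
qed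

end
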